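(* Let $F\colon \mathbb{R}^2 \to \mathbb{R}^2$ be a differentiable (not necessarily $C^1$) map such that $\operatorname{Spec}(F)\cap\mathbb{R}=\emptyset$. Then $\#\operatorname{Fix}(F^2)\le 1$.
   Context: For a differentiable map $F\colon\mathbb{R}^2\to\mathbb{R}^2$, $\operatorname{Spec}(F)$ denotes the set of all complex eigenvalues of the derivatives $DF_p$ as $p$ ranges over $\mathbb{R}^2$. $F^2=F\circ F$ is the second iterate, and $\operatorname{Fix}(H)$ denotes the set of fixed points of a map $H$. Differentiable means differentiable at every point (in the Fréchet sense); the derivative need not be continuous. *)

theory Defs
  imports "HOL-Analysis.Analysis"
begin

definition complex_eigenvalues :: "real^'n^'n \<Rightarrow> complex set" where
  "complex_eigenvalues A =
     {z. \<exists>v :: complex^'n. v \<noteq> 0 \<and> map_matrix complex_of_real A *v v = z *s v}"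

(* Only meaningful for maps differentiable everywhere: at other points
   jacobian has an unspecified value. *)
definition Spec :: "(real^'n \<Rightarrow> real^'n) \<Rightarrow> complex set" where
  "Spec F = (\<Union>p. complex_eigenvalues (jacobian F (at p)))"

definition Fix :: "('a \<Rightarrow> 'a) \<Rightarrow> 'a set" where
  "Fix H = {x. H x = x}"

end

theory Submission
  imports Defs
begin

text \<open>A chord of \<open>F\<close> is never mapped to a parallel vector: if \<open>F p - F q\<close> were parallel to
  \<open>v = p - q \<noteq> 0\<close>, then for \<open>w\<close> orthogonal to \<open>v\<close> the function
  \<open>t \<mapsto> w \<bullet> F (q + t v)\<close> would agree at \<open>0\<close> and \<open>1\<close>, so by the mean value theorem its derivative
  \<open>w \<bullet> DF v\<close> would vanish somewhere, making \<open>v\<close> a real eigenvector of \<open>DF\<close> there. Two fixed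
  points of \<open>F\<close>, as well as a 2-cycle of \<open>F\<close>, form a chord mapped to a parallel one.\<close>

text \<open>Embedding \<open>u\<close> coordinatewise into \<open>complex^'n\<close> keeps the
  eigenvalue equation, since \<open>of_real\<close> commutes with finite sums and products.\<close>

lemma real_eigenvector_in_complex_eigenvalues:
  fixes A :: "real^'n^'n"
  assumes "A *v u = c *\<^sub>R u" and "u \<noteq> 0"
  shows "complex_of_real c \<in> complex_eigenvalues A"
proof -
  let ?v = "\<chi> i. complex_of_real (u $ i)"
  have "?v \<noteq> 0"
    using assms(2) by (simp add: vec_eq_iff)
  moreover have "map_matrix complex_of_real A *v ?v = complex_of_real c *s ?v"
  proof -
    have "(\<Sum>j\<in>UNIV. A $ i $ j * u $ j) = c * u $ i" for i
      using assms(1) by (simp add: vec_eq_iff matrix_vector_mult_def)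
    then have "(\<Sum>j\<in>UNIV. complex_of_real (A $ i $ j) * complex_of_real (u $ j))
        = complex_of_real c * complex_of_real (u $ i)" for i
      by (metis (mono_tags, lifting) of_real_mult of_real_sum sum.cong)
    then show ?thesis
      by (simp add: vec_eq_iff matrix_vector_mult_def map_matrix_def)
  qed
  ultimately show ?thesis
    unfolding complex_eigenvalues_def by blast
qed

text \<open>The vector in the inner product is \<open>v\<close> turned by a right angle; in the
  plane its orthogonal complement is the line spanned by \<open>v\<close>. The factor
  \<open>c\<close> is a quotient of coordinates, so the cases pick a nonzero coordinate of
  \<open>v\<close>.\<close>

lemma parallel_if_orthogonal_to_rotation:
  fixes x v :: "real^2"
  assumes "v \<noteq> 0" and "vector [- v $ 2, v $ 1] \<bullet> x = 0"
  shows "\<exists>c. x = c *\<^sub>R v"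
proof (cases "v $ 1 = 0")
  case True
  then have "v $ 2 \<noteq> 0" "x $ 1 = 0"
    using assms by (auto simp: vec_eq_iff forall_2 inner_vec_def sum_2)
  with True have "x = (x $ 2 / v $ 2) *\<^sub>R v"
    by (simp add: vec_eq_iff forall_2)
  then show ?thesis ..
next
  case False
  then have "x = (x $ 1 / v $ 1) *\<^sub>R v"
    using assms(2) by (simp add: vec_eq_iff forall_2 inner_vec_def sum_2 field_simps)
  then show ?thesis ..
qed

lemma chord_image_not_parallel:
  fixes F :: "real^2 \<Rightarrow> real^2"
  assumes diff: "F differentiable_on UNIV"
    and spec: "Spec F \<inter> \<real> = {}"
    and "p \<noteq> q"
  shows "F p - F q \<noteq> c *\<^sub>R (p - q)"
proof
  assume par: "F p - F q = c *\<^sub>R (p - q)"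
  define v where "v = p - q"
  define w :: "real^2" where "w = vector [- v $ 2, v $ 1]"
  define J where "J x = jacobian F (at x)" for x
  define \<phi> where "\<phi> t = w \<bullet> F (q + t *\<^sub>R v)" for t
  have "v \<noteq> 0"
    using \<open>p \<noteq> q\<close> by (simp add: v_def)
  have F': "(F has_derivative (\<lambda>h. J x *v h)) (at x)" for x
    using diff by (simp add: J_def differentiable_on_def jacobian_works)
  have line: "((\<lambda>t. q + t *\<^sub>R v) has_derivative (\<lambda>h. h *\<^sub>R v)) (at t)" for t :: real
    by (auto intro!: derivative_eq_intros)
  have \<phi>': "(\<phi> has_derivative (\<lambda>h. w \<bullet> (J (q + t *\<^sub>R v) *v (h *\<^sub>R v)))) (at t)" for t
    unfolding \<phi>_def
    by (rule has_derivative_inner_right[OF has_derivative_compose[OF line F']])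
  \<comment> \<open>Pairing with \<open>w\<close> makes the function scalar, so the mean value
    theorem gives an equality, using only pointwise differentiability.\<close>
  obtain t where t: "\<phi> 1 - \<phi> 0 = w \<bullet> (J (q + t *\<^sub>R v) *v ((1 - 0) *\<^sub>R v))"
    using mvt_very_simple[of 0 1 \<phi>, OF _ has_derivative_at_withinI[OF \<phi>']] by auto
  have "\<phi> 1 - \<phi> 0 = w \<bullet> (c *\<^sub>R v)"
    using par by (simp add: \<phi>_def v_def inner_diff_right[symmetric])
  also have "\<dots> = 0"
    by (simp add: w_def inner_vec_def sum_2)
  finally have "w \<bullet> (J (q + t *\<^sub>R v) *v v) = 0"
    using t by simp
  then obtain d where "J (q + t *\<^sub>R v) *v v = d *\<^sub>R v"
    using parallel_if_orthogonal_to_rotation \<open>v \<noteq> 0\<close> unfolding w_def by blast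
  then have "complex_of_real d \<in> Spec F"
    using real_eigenvector_in_complex_eigenvalues \<open>v \<noteq> 0\<close> unfolding Spec_def J_def by blast
  then show False
    using spec by auto
qed

theorem theorem3:
  fixes F :: "real^2 \<Rightarrow> real^2"
  assumes "F differentiable_on UNIV"
    and "Spec F \<inter> \<real> = {}"
  shows "finite (Fix (F ^^ 2)) \<and> card (Fix (F ^^ 2)) \<le> 1"
proof -
  note not_par = chord_image_not_parallel[OF assms]
  have fixed: "F p = p" if "p \<in> Fix (F ^^ 2)" for p
  proof (rule ccontr)
    assume "F p \<noteq> p"
    moreover have "F (F p) = p"
      using that by (simp add: Fix_def numeral_2_eq_2)
    ultimately show False
      \<comment> \<open>\<open>F\<close> swaps the ends of the chord from \<open>p\<close> to
        \<open>F p\<close>, hence the factor -1.\<close>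
      using not_par[of "F p" p "-1"] by simp
  qed
  have unique: "p = q" if "p \<in> Fix (F ^^ 2)" "q \<in> Fix (F ^^ 2)" for p q
    using not_par[of p q 1] fixed[OF that(1)] fixed[OF that(2)] by auto
  \<comment> \<open>If there are no fixed points, any \<open>p\<close> will do.\<close>
  then obtain p where "Fix (F ^^ 2) \<subseteq> {p}"
    by blast
  then show ?thesis
    using finite_subset[of _ "{p}"] card_mono[of "{p}" "Fix (F ^^ 2)"] by simp
qed

end
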